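(* Let $G$ be a connected graph of order $n$, minimum degree $\delta$ and maximum degree $\Delta$. If $\Delta > \frac{n}{2}-1$, then \[ \pi(G) \leq \frac{3(n-\Delta)^2}{2(n-1)(\delta+1)} + \frac{13}{2}. \] If $\Delta \leq \frac{n}{2}-1$, then \[ \pi(G) \leq \frac{3(n^2-2\Delta^2)}{4(n-1)(\delta+1)} + \frac{35}{4}. \]
   Context: For a connected graph $G$ of order $n \ge 2$ and a vertex $v$, the average distance of $v$ is $\overline{\sigma}(v,G) = \frac{1}{n-1}\sum_{u \in V(G)} d(v,u)$, where $d$ is the shortest-path distance. The proximity $\pi(G)$ is the minimum of $\overline{\sigma}(v,G)$ over all vertices $v$ of $G$. *)

theory Defs
  imports "Graph_Theory.Graph_Theory"
begin

text \<open>
  A finite simple graph is a digraph satisfying the locale predicate \<^const>\<open>graph\<close>: finite,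
  symmetric, without loops and without parallel arcs. Each undirected edge is a pair of opposite
  arcs, so the degree of a vertex is its out-degree.
\<close>

definition min_degree :: "('a, 'b) pre_digraph \<Rightarrow> nat" where
  "min_degree G = (MIN v\<in>verts G. out_degree G v)"

definition max_degree :: "('a, 'b) pre_digraph \<Rightarrow> nat" where
  "max_degree G = (MAX v\<in>verts G. out_degree G v)"

text \<open>
  \<^const>\<open>wf_digraph.\<mu>\<close> with unit arc weights is the infimum of the walk lengths; it is \<open>\<infinity>\<close> between
  different components, which \<^const>\<open>real_of_ereal\<close> maps to \<open>0\<close>, so the definition is meaningful
  for connected graphs only.
\<close>

definition distance :: "('a, 'b) pre_digraph \<Rightarrow> 'a \<Rightarrow> 'a \<Rightarrow> real" where
  "distance G u v = real_of_ereal (wf_digraph.\<mu> G (\<lambda>_. 1) u v)"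

definition average_distance :: "('a, 'b) pre_digraph \<Rightarrow> 'a \<Rightarrow> real" where
  "average_distance G v = 1 / (real (card (verts G)) - 1) * (\<Sum>u\<in>verts G. distance G v u)"

definition proximity :: "('a, 'b) pre_digraph \<Rightarrow> real" where
  "proximity G = (MIN v\<in>verts G. average_distance G v)"

end

theory Submission
  imports Defs
begin

text \<open>
  Starting from a vertex \<open>w\<close> of maximum degree, choose a maximal set \<open>A\<close> of vertices that are pairwise
  at distance at least 3 and connected by steps of length 3. By maximality every vertex is within
  distance 2 of \<open>A\<close>, and the closed neighbourhoods of the elements of \<open>A\<close> are disjoint. Moving every
  vertex to a nearby element of \<open>A\<close> yields a weighted tree on \<open>A\<close> in which each weight is at least
  \<open>\<delta> + 1\<close> and the root \<open>w\<close> has weight at least \<open>\<Delta> + 1\<close>; distances change by at most 2 and by a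
  factor 3. A branch of total weight \<open>W\<close> is split into nonempty layers, so its distance sum is at most
  about \<open>W\<^sup>2 / (2 (\<delta> + 1))\<close>, and a branch containing \<open>w\<close> saves about \<open>\<Delta>\<^sup>2 / (2 (\<delta> + 1))\<close>.
  If \<open>\<Delta> + 1 > n / 2\<close> take the distance sum of \<open>w\<close>; otherwise take that of a weighted median of the
  tree, all of whose branches have weight at most \<open>n / 2\<close>.
\<close>

section \<open>Weighted layers and depth functions\<close>

text \<open>The levels fill \<open>1..m\<close>, each layer weighs at least \<open>D\<close> and one
  weighs at least \<open>M\<close>. Replacing \<open>L i\<close> by \<open>D\<close> in the sum of
  \<open>L i * (m - i)\<close> bounds the weighted sum of levels. Completing the square in the total
  weight \<open>W\<close> then eliminates \<open>m\<close>, and the slack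
  \<open>W - m * D \<ge> M - D\<close> gives the saving.\<close>

lemma layered_weight_bound:
  fixes c :: "'a \<Rightarrow> real" and l :: "'a \<Rightarrow> nat"
  assumes fin: "finite B" and D: "0 < D" "D \<le> M"
    and c: "\<And>b. b \<in> B \<Longrightarrow> D \<le> c b" and x: "x \<in> B" "M \<le> c x"
    and l: "\<And>b. b \<in> B \<Longrightarrow> l b = 1 \<or> (\<exists>b'\<in>B. l b = Suc (l b'))"
  shows "2 * D * (\<Sum>b\<in>B. c b * l b) \<le> (sum c B)\<^sup>2 - (M - D)\<^sup>2 + D * sum c B"
proof -
  define m where "m = Max (l ` B)"
  define L where "L i = (\<Sum>b\<in>{b\<in>B. l b = i}. c b)" for i
  have pos: "1 \<le> l b" if "b \<in> B" for b
    using l[OF that] by auto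
  have le_m: "l b \<le> m" if "b \<in> B" for b
    using that fin by (simp add: m_def)
  have "m \<in> l ` B"
    unfolding m_def using fin x by (intro Max_in) auto
  then obtain t where t: "t \<in> B" "l t = m" by auto
  \<comment> \<open>Levels descend in steps of one down to 1, so no layer between 1 and
    \<open>m\<close> is empty.\<close>
  have down: "\<exists>b\<in>B. l b = i" if "1 \<le> i" "i \<le> l t'" "t' \<in> B" for i t'
    using that
  proof (induction "l t'" arbitrary: t')
    case (Suc k)
    show ?case
    proof (cases "i = Suc k")
      case False
      with Suc l[OF \<open>t' \<in> B\<close>] show ?thesis
        by (metis One_nat_def Suc_inject le_SucE le_antisym)
    qed (use Suc in metis)
  qed (use pos in auto)
  have c_nonneg: "0 \<le> c b" if "b \<in> B" for b
    using c[OF that] D by simp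
  have single: "c b \<le> L (l b)" if "b \<in> B" for b
    unfolding L_def using that fin c_nonneg by (intro member_le_sum) auto
  have L_ge: "D \<le> L i" if "i \<in> {1..m}" for i
    using down[of i t] that t single c by (force intro: order_trans)
  have lx: "l x \<in> {1..m}" using pos le_m x by auto
  have group: "(\<Sum>i\<in>{1..m}. \<Sum>b\<in>{b\<in>B. l b = i}. g b) = sum g B" for g :: "'a \<Rightarrow> real"
    using fin pos le_m by (intro sum.group) auto
  have W: "sum c B = (\<Sum>i\<in>{1..m}. L i)"
    unfolding L_def by (rule group[symmetric])
  \<comment> \<open>The layer of \<open>x\<close> weighs at least \<open>M\<close>, each of the
    other \<open>m - 1\<close> layers at least \<open>D\<close>.\<close>
  have "(real m - 1) * D + M \<le> sum c B"
  proof -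
    have "(real m - 1) * D = (\<Sum>i\<in>{1..m} - {l x}. D)"
      using lx by (simp add: of_nat_diff)
    also have "\<dots> \<le> (\<Sum>i\<in>{1..m} - {l x}. L i)"
      using L_ge by (intro sum_mono) auto
    finally have "(real m - 1) * D \<le> (\<Sum>i\<in>{1..m} - {l x}. L i)" .
    moreover have "sum c B = L (l x) + (\<Sum>i\<in>{1..m} - {l x}. L i)"
      unfolding W using lx by (intro sum.remove) auto
    ultimately show ?thesis
      using single[OF x(1)] x(2) by linarith
  qed
  then have xW: "m * D \<le> sum c B - M + D" by (simp add: algebra_simps)
  have gauss: "2 * (\<Sum>i\<in>{1..m}. real m - real i) = real m * (real m - 1)"
  proof -
    have "2 * (\<Sum>i\<in>{1..m}. real i) = real m * (real m + 1)"
      by (induction m) (auto simp: algebra_simps)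
    then show ?thesis by (simp add: sum_subtractf algebra_simps)
  qed
  have "D * (\<Sum>i\<in>{1..m}. real m - real i) \<le> (\<Sum>i\<in>{1..m}. L i * (real m - real i))"
    unfolding sum_distrib_left using L_ge by (intro sum_mono mult_right_mono) auto
  also have "\<dots> = (\<Sum>i\<in>{1..m}. \<Sum>b\<in>{b\<in>B. l b = i}. c b * (real m - l b))"
    unfolding L_def by (intro sum.cong refl) (simp add: sum_distrib_right)
  also have "\<dots> = real m * sum c B - (\<Sum>b\<in>B. c b * l b)"
    unfolding group by (simp add: algebra_simps sum_subtractf sum_distrib_left)
  finally have "2 * (\<Sum>b\<in>B. c b * l b) \<le> 2 * real m * sum c B - D * (real m * (real m - 1))"
    unfolding gauss[symmetric] by (simp add: algebra_simps)
  then have "D * (2 * (\<Sum>b\<in>B. c b * l b)) \<le> D * (2 * real m * sum c B - D * (real m * (real m - 1)))"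
    using D by (intro mult_left_mono) auto
  also have "\<dots> = (sum c B)\<^sup>2 - (sum c B - m * D)\<^sup>2 + D * (m * D)"
    by (simp add: power2_eq_square algebra_simps)
  also have "\<dots> \<le> (sum c B)\<^sup>2 - (M - D)\<^sup>2 + D * sum c B"
  proof -
    have "(M - D)\<^sup>2 \<le> (sum c B - m * D)\<^sup>2"
      using xW D by (intro power_mono) auto
    moreover have "D * (m * D) \<le> D * sum c B"
      using xW D by (intro mult_left_mono) auto
    ultimately show ?thesis by linarith
  qed
  finally show ?thesis by (simp add: algebra_simps)
qed

text \<open>\<open>h\<close> is breadth-first depth, the least number of \<open>R\<close>-steps from
  \<open>x\<close>. It serves twice: to root the packing at \<open>w\<close>, and to layer the
  complement of a subtree.\<close>

lemma connected_depth_exists: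
  assumes R: "R \<subseteq> B \<times> B" and x: "x \<in> B" and conn: "\<And>b. b \<in> B \<Longrightarrow> (x, b) \<in> R\<^sup>*"
  obtains h :: "'a \<Rightarrow> nat" where "h x = 0"
    "\<And>b. b \<in> B \<Longrightarrow> b \<noteq> x \<Longrightarrow> \<exists>b'\<in>B. (b', b) \<in> R \<and> h b = Suc (h b')"
proof -
  define h where "h b = (LEAST k. (x, b) \<in> R ^^ k)" for b
  have h: "(x, b) \<in> R ^^ h b" if "b \<in> B" for b
    unfolding h_def using conn[OF that] by (metis LeastI_ex rtrancl_imp_relpow)
  have h_le: "h b \<le> k" if "(x, b) \<in> R ^^ k" for b k
    unfolding h_def using that by (rule Least_le)
  have "\<exists>b'\<in>B. (b', b) \<in> R \<and> h b = Suc (h b')" if b: "b \<in> B" "b \<noteq> x" for b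
  proof -
    from b obtain k where k: "h b = Suc k"
      using h[of b] by (cases "h b") auto
    then obtain b' where b': "(x, b') \<in> R ^^ k" "(b', b) \<in> R"
      using h[OF b(1)] by auto
    have "b' \<in> B" using b' R by auto
    \<comment> \<open>A shorter route to \<open>b'\<close> would give a shorter route to
      \<open>b\<close>.\<close>
    moreover have "h b' = k"
      using h_le[OF b'(1)] h_le[of b "Suc (h b')"] h[OF \<open>b' \<in> B\<close>] b'(2) k by auto
    ultimately show ?thesis
      using k b' by auto
  qed
  moreover have "h x = 0" using h_le[of x 0] by simp
  ultimately show thesis using that by blast
qed

section \<open>Weighted rooted trees: branch bounds and the median\<close>

text \<open>Tree edges have length at most \<open>s\<close> in \<open>d\<close>, so \<open>d\<close>
  is at most \<open>s\<close> times the tree distance. In the application \<open>c\<close> counts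
  graph vertices, \<open>D\<close> is \<delta> + 1, \<open>M\<close> is \<Delta> + 1 and
  \<open>s\<close> is 3.\<close>

locale weighted_tree =
  fixes A :: "'a set" and w :: 'a and p :: "'a \<Rightarrow> 'a" and h :: "'a \<Rightarrow> nat"
    and c :: "'a \<Rightarrow> real" and D M :: real and d :: "'a \<Rightarrow> 'a \<Rightarrow> nat" and s :: nat
  assumes finite_A: "finite A" and root_in: "w \<in> A" and h_root: "h w = 0"
    and parent_in: "b \<in> A \<Longrightarrow> b \<noteq> w \<Longrightarrow> p b \<in> A"
    and h_parent: "b \<in> A \<Longrightarrow> b \<noteq> w \<Longrightarrow> h b = Suc (h (p b))"
    and D_pos: "0 < D" and D_le_M: "D \<le> M"
    and c_ge: "b \<in> A \<Longrightarrow> D \<le> c b" and c_root: "M \<le> c w"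
    and d_refl: "x \<in> A \<Longrightarrow> d x x = 0"
    and d_sym: "x \<in> A \<Longrightarrow> y \<in> A \<Longrightarrow> d x y = d y x"
    and d_triangle: "x \<in> A \<Longrightarrow> y \<in> A \<Longrightarrow> z \<in> A \<Longrightarrow> d x z \<le> d x y + d y z"
    and d_parent: "b \<in> A \<Longrightarrow> b \<noteq> w \<Longrightarrow> d b (p b) \<le> s"
begin

definition parent_rel :: "('a \<times> 'a) set" where
  "parent_rel = {(b, p b) | b. b \<in> A \<and> b \<noteq> w}"

definition desc :: "'a \<Rightarrow> 'a set" where
  "desc b = {x \<in> A. (x, b) \<in> parent_rel\<^sup>*}"

definition children :: "'a \<Rightarrow> 'a set" where
  "children a = {b \<in> A. b \<noteq> w \<and> p b = a}"

text \<open>The levels \<open>l\<close> stand for numbers of edges from \<open>a\<close>. For a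
  branch containing the root, \<open>K\<close> will be \<open>M\<close>; otherwise it will be
  \<open>D\<close>, and the correction vanishes.\<close>

lemma branch_bound:
  assumes "B \<subseteq> A" "D \<le> K" "x \<in> B" "K \<le> c x"
    and l: "\<And>b. b \<in> B \<Longrightarrow> l b = 1 \<or> (\<exists>b'\<in>B. l b = Suc (l b'))"
    and dl: "\<And>b. b \<in> B \<Longrightarrow> d a b \<le> s * l b"
  shows "2 * D * (\<Sum>b\<in>B. c b * d a b) \<le> s * ((sum c B)\<^sup>2 - (K - D)\<^sup>2 + D * sum c B)"
proof -
  have "c b * d a b \<le> s * (c b * l b)" if "b \<in> B" for b
  proof -
    have "0 \<le> c b" using c_ge[of b] D_pos that assms(1) by force
    then have "c b * d a b \<le> c b * (s * l b)"
      using dl[OF that] by (intro mult_left_mono) (metis of_nat_le_iff of_nat_mult)+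
    then show ?thesis by (simp add: algebra_simps)
  qed
  then have "(\<Sum>b\<in>B. c b * d a b) \<le> s * (\<Sum>b\<in>B. c b * l b)"
    unfolding sum_distrib_left by (rule sum_mono)
  then have "2 * D * (\<Sum>b\<in>B. c b * d a b) \<le> 2 * D * (s * (\<Sum>b\<in>B. c b * l b))"
    using D_pos by (intro mult_left_mono) auto
  also have "\<dots> = s * (2 * D * (\<Sum>b\<in>B. c b * l b))"
    by (simp add: algebra_simps)
  also have "\<dots> \<le> s * ((sum c B)\<^sup>2 - (K - D)\<^sup>2 + D * sum c B)"
    using assms finite_subset[OF assms(1) finite_A] D_pos c_ge
    by (intro mult_left_mono layered_weight_bound[where x = x]) auto
  finally show ?thesis .
qed

lemma parent_rel_step: "(x, y) \<in> parent_rel \<Longrightarrow> x \<in> A \<and> y \<in> A \<and> x \<noteq> w \<and> y = p x \<and> h x = Suc (h y)"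
  unfolding parent_rel_def using parent_in h_parent by auto

text \<open>The path up from \<open>x\<close> to \<open>y\<close> has \<open>h x - h y\<close>
  edges, each of length at most \<open>s\<close>.\<close>

lemma parent_rel_rtrancl:
  assumes "(x, y) \<in> parent_rel\<^sup>*" "x \<in> A"
  shows "y \<in> A \<and> h y \<le> h x \<and> d y x \<le> s * (h x - h y)"
  using assms
proof (induction rule: rtrancl_induct)
  case (step y z)
  note parent_rel_step[OF step(2)]
  moreover from this have "d z y \<le> s"
    using d_parent d_sym by metis
  moreover have "d z x \<le> d z y + d y x"
    using calculation step by (intro d_triangle) auto
  moreover have "h x - h z = Suc (h x - h y)"
    using calculation step by auto
  ultimately show ?case using step by auto
qed (simp add: d_refl)

lemma reach_root: "x \<in> A \<Longrightarrow> (x, w) \<in> parent_rel\<^sup>*"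
proof (induction "h x" arbitrary: x rule: less_induct)
  case less
  show ?case
  proof (cases "x = w")
    case False
    then have "(x, p x) \<in> parent_rel" using less by (auto simp: parent_rel_def)
    with less False parent_in h_parent show ?thesis
      by (metis converse_rtrancl_into_rtrancl lessI)
  qed simp
qed

lemma desc_root: "desc w = A"
  using reach_root by (auto simp: desc_def)

lemma desc_subset: "desc a \<subseteq> A"
  by (auto simp: desc_def)

lemma desc_unfold:
  assumes "a \<in> A"
  shows "desc a = insert a (\<Union>b\<in>children a. desc b)"
proof
  show "desc a \<subseteq> insert a (\<Union>b\<in>children a. desc b)"
  proof
    fix x assume x: "x \<in> desc a"
    then have "(x, a) \<in> parent_rel\<^sup>*" by (simp add: desc_def)
    then show "x \<in> insert a (\<Union>b\<in>children a. desc b)"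
    proof (cases rule: rtranclE)
      case (step b)
      with x parent_rel_step[OF step(2)] show ?thesis
        by (auto simp: desc_def children_def)
    qed auto
  qed
  show "insert a (\<Union>b\<in>children a. desc b) \<subseteq> desc a"
    using assms
    by (auto simp: desc_def children_def parent_rel_def intro: rtrancl_into_rtrancl)
qed

lemma h_child: "b \<in> children a \<Longrightarrow> h b = Suc (h a)"
  using h_parent by (auto simp: children_def)

lemma not_in_desc_child: "b \<in> children a \<Longrightarrow> a \<notin> desc b"
  using h_child[of b a] parent_rel_rtrancl[of a b] by (auto simp: desc_def)

text \<open>Parents are unique, so two ancestors of one vertex are comparable; distinct siblings are
  not, having equal depth.\<close>

lemma desc_children_disjoint:
  assumes "b \<in> children a" "b' \<in> children a" "b \<noteq> b'"
  shows "desc b \<inter> desc b' = {}"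
proof (rule ccontr)
  assume "desc b \<inter> desc b' \<noteq> {}"
  then obtain x where x: "(x, b) \<in> parent_rel\<^sup>*" "(x, b') \<in> parent_rel\<^sup>*" by (auto simp: desc_def)
  have no: False if "(b1, b2) \<in> parent_rel\<^sup>*" "b1 \<in> children a" "b2 \<in> children a" "b1 \<noteq> b2" for b1 b2
  proof -
    from that(1,4) obtain y where y: "(b1, y) \<in> parent_rel" "(y, b2) \<in> parent_rel\<^sup>*"
      by (auto elim: converse_rtranclE)
    have "h b2 \<le> h y" using parent_rel_rtrancl[OF y(2)] parent_rel_step[OF y(1)] by auto
    then show False using parent_rel_step[OF y(1)] h_child[OF that(2)] h_child[OF that(3)] by auto
  qed
  have "single_valued parent_rel" by (auto simp: single_valued_def parent_rel_def)
  from single_valued_confluent[OF this x] show False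
    using no[of b b'] no[of b' b] assms by auto
qed

lemma sum_desc:
  fixes f :: "'a \<Rightarrow> real"
  assumes "a \<in> A"
  shows "sum f (desc a) = f a + (\<Sum>b\<in>children a. sum f (desc b))"
proof -
  have fin: "finite (children a)" "\<And>b. finite (desc b)"
    using finite_A desc_subset by (auto simp: children_def intro: finite_subset)
  have "sum f (desc a) = f a + sum f (\<Union>b\<in>children a. desc b)"
    unfolding desc_unfold[OF assms]
    using fin not_in_desc_child by (intro sum.insert) auto
  also have "sum f (\<Union>b\<in>children a. desc b) = (\<Sum>b\<in>children a. sum f (desc b))"
    using fin desc_children_disjoint by (intro sum.UNION_disjoint) auto
  finally show ?thesis .
qed

text \<open>Levels are depths relative to \<open>a\<close>, so \<open>b\<close> has level 1. The
  root lies outside this branch, so \<open>K\<close> is only \<open>D\<close>.\<close>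

lemma child_branch_bound:
  assumes a: "a \<in> A" and b: "b \<in> children a"
  shows "2 * D * (\<Sum>x\<in>desc b. c x * d a x) \<le> s * ((sum c (desc b))\<^sup>2 + D * sum c (desc b))"
proof -
  have bA: "b \<in> A" and bw: "b \<noteq> w" using b by (auto simp: children_def)
  have below: "h b \<le> h x" if "x \<in> desc b" for x
    using parent_rel_rtrancl that by (auto simp: desc_def)
  have "2 * D * (\<Sum>x\<in>desc b. c x * d a x) \<le>
    s * ((sum c (desc b))\<^sup>2 - (D - D)\<^sup>2 + D * sum c (desc b))"
  proof (rule branch_bound[where x = b and l = "\<lambda>x. h x - h a"])
    fix x assume x: "x \<in> desc b"
    then have "(x, b) \<in> parent_rel\<^sup>*" by (simp add: desc_def)
    then show "h x - h a = 1 \<or> (\<exists>b'\<in>desc b. h x - h a = Suc (h b' - h a))"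
    proof (cases rule: converse_rtranclE)
      case base
      then show ?thesis using h_child[OF b] by auto
    next
      case (step y)
      then have y: "y \<in> desc b" "h x = Suc (h y)"
        using parent_rel_step[OF step(1)] by (auto simp: desc_def)
      then show ?thesis using below[OF y(1)] h_child[OF b] by (intro disjI2 bexI[of _ y]) auto
    qed
    have "(x, a) \<in> parent_rel\<^sup>*" using x desc_unfold[OF a] b by (auto simp: desc_def)
    then show "d a x \<le> s * (h x - h a)"
      using parent_rel_rtrancl[of x a] x by (auto simp: desc_def)
  qed (use bA c_ge in \<open>auto simp: desc_def\<close>)
  then show ?thesis by simp
qed

text \<open>All vertices other than \<open>w\<close> are layered together by depth; the weight
  \<open>c w\<close> at distance 0 drops out of the total.\<close>

lemma root_bound:
  "2 * D * (\<Sum>b\<in>A. c b * d w b) \<le> s * ((sum c A - c w)\<^sup>2 + D * (sum c A - c w))"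
proof (cases "A = {w}")
  \<comment> \<open>A branch must be nonempty, so the tree with one vertex is treated apart; both
    sides are 0.\<close>
  case True
  then show ?thesis using d_refl[OF root_in] by simp
next
  case False
  then obtain x where x: "x \<in> A - {w}" using root_in by auto
  have W: "sum c (A - {w}) = sum c A - c w"
    using finite_A root_in by (simp add: sum_diff1)
  have "2 * D * (\<Sum>b\<in>A - {w}. c b * d w b) \<le>
    s * ((sum c (A - {w}))\<^sup>2 - (D - D)\<^sup>2 + D * sum c (A - {w}))"
  proof (rule branch_bound[where x = x and l = h])
    fix b assume b: "b \<in> A - {w}"
    then show "h b = 1 \<or> (\<exists>b'\<in>A - {w}. h b = Suc (h b'))"
      using parent_in h_parent h_root by (cases "p b = w") force+
    show "d w b \<le> s * h b"
      using parent_rel_rtrancl[of b w] reach_root[of b] b h_root by auto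
  qed (use x c_ge in auto)
  moreover have "(\<Sum>b\<in>A. c b * d w b) = (\<Sum>b\<in>A - {w}. c b * d w b)"
    using finite_A root_in d_refl by (simp add: sum.remove[of A w])
  ultimately show ?thesis by (simp add: W)
qed

text \<open>\<open>U\<close> is the branch that \<open>a\<close> enters through its parent. It
  contains \<open>w\<close>, whence the saving in terms of \<open>M\<close>.\<close>

lemma up_branch_bound:
  assumes a: "a \<in> A" "a \<noteq> w"
  defines "U \<equiv> A - desc a"
  shows "2 * D * (\<Sum>b\<in>U. c b * d a b) \<le> s * ((sum c U)\<^sup>2 - (M - D)\<^sup>2 + D * sum c U)"
proof -
  \<comment> \<open>Paths from \<open>p a\<close> inside \<open>U\<close> first climb and then
    descend, so tree edges are taken in both directions.\<close>
  define R where "R = (parent_rel \<union> parent_rel\<inverse>) \<inter> U \<times> U"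
  have symR: "sym R" by (auto simp: R_def sym_def)
  have UA: "U \<subseteq> A" by (auto simp: U_def)
  \<comment> \<open>A subtree contains all descendants of its members, so its complement is closed
    under parents and every path from \<open>U\<close> to the root stays in
    \<open>U\<close>.\<close>
  have up: "y \<in> U" if "(x, y) \<in> parent_rel" "x \<in> U" for x y
    using that parent_rel_step[OF that(1)]
    by (auto simp: U_def desc_def intro: converse_rtrancl_into_rtrancl)
  have reach: "(x, y) \<in> R\<^sup>* \<and> y \<in> U" if "(x, y) \<in> parent_rel\<^sup>*" "x \<in> U" for x y
    using that
  proof (induction rule: rtrancl_induct)
    case (step y z)
    then show ?case using up by (auto simp: R_def intro: rtrancl_into_rtrancl)
  qed simp
  have pa: "p a \<in> U"
    using parent_rel_rtrancl[of "p a" a] parent_in[OF a] h_parent[OF a] by (auto simp: U_def desc_def)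
  have to_w: "(b, w) \<in> R\<^sup>*" "w \<in> U" if "b \<in> U" for b
    using reach[of b w] reach_root that by (auto simp: U_def)
  have conn: "(p a, b) \<in> R\<^sup>*" if "b \<in> U" for b
    using to_w(1)[OF pa] to_w(1)[OF that] symR by (meson rtrancl_trans symD sym_rtrancl)
  obtain k :: "'a \<Rightarrow> nat" where k: "k (p a) = 0"
    "\<And>b. b \<in> U \<Longrightarrow> b \<noteq> p a \<Longrightarrow> \<exists>b'\<in>U. (b', b) \<in> R \<and> k b = Suc (k b')"
    using connected_depth_exists[of R U "p a"] pa conn by (auto simp: R_def)
  have dR: "d x y \<le> s" if "(x, y) \<in> R" for x y
    using that d_parent d_sym parent_rel_step by (auto simp: R_def) metis+
  show ?thesis
  \<comment> \<open>Levels count edges from \<open>a\<close>, and \<open>p a\<close> is already one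
    edge away: hence \<open>Suc (k x)\<close>.\<close>
  proof (rule branch_bound[where x = w and l = "\<lambda>x. Suc (k x)"])
    fix b assume b: "b \<in> U"
    then show "Suc (k b) = 1 \<or> (\<exists>b'\<in>U. Suc (k b) = Suc (Suc (k b')))"
      using k by (cases "b = p a") force+
    show "d a b \<le> s * Suc (k b)"
      using b
    proof (induction "k b" arbitrary: b rule: less_induct)
      case less
      show ?case
      proof (cases "b = p a")
        case True
        then show ?thesis using d_parent[OF a] k(1) by simp
      next
        case False
        then obtain b' where b': "b' \<in> U" "(b', b) \<in> R" "k b = Suc (k b')"
          using k(2) less(2) by blast
        then have "d a b' \<le> s * Suc (k b')" using less(1) by simp
        moreover have "d a b \<le> d a b' + d b' b"
          using a b' less(2) UA by (intro d_triangle) auto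
        ultimately show ?thesis using dR[OF b'(2)] b'(3) by simp
      qed
    qed
  qed (use UA D_le_M c_root to_w pa in auto)
qed

text \<open>The deepest vertex \<open>a\<close> whose subtree has at least half of the total weight
  \<open>N\<close> is a weighted median: every branch at \<open>a\<close> weighs at most
  \<open>N / 2\<close>. A branch of weight \<open>x\<close> then costs at most
  \<open>x * x + D * x \<le> (N / 2 + D) * x\<close>, which is additive over branches. The upward
  branch also supplies the saving.\<close>

lemma median_bound:
  assumes "2 * M \<le> sum c A"
  shows "\<exists>a\<in>A. 2 * D * (\<Sum>b\<in>A. c b * d a b) \<le>
           s * ((sum c A)\<^sup>2 / 2 - (M - D)\<^sup>2 + D * sum c A)"
proof -
  define N where "N = sum c A"
  define S where "S a = sum c (desc a)" for a
  define H where "H = {a \<in> A. N \<le> 2 * S a}"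
  have c0: "0 \<le> c b" if "b \<in> A" for b
    using c_ge[OF that] D_pos by simp
  have N0: "0 \<le> N" unfolding N_def using c0 by (rule sum_nonneg)
  have S0: "0 \<le> S b" for b
    unfolding S_def using c0 desc_subset by (intro sum_nonneg) auto
  have "w \<in> H" using root_in N0 by (simp add: H_def S_def desc_root N_def)
  moreover have "finite H" using finite_A by (simp add: H_def)
  ultimately have "Max (h ` H) \<in> h ` H"
    by (intro Max_in) auto
  then obtain a where aH: "a \<in> H" and a_max: "h a = Max (h ` H)" by auto
  have aA: "a \<in> A" and Sa: "N \<le> 2 * S a" using aH by (auto simp: H_def)
  have child: "S b \<le> N / 2" if b: "b \<in> children a" for b
  proof (rule ccontr)
    assume "\<not> S b \<le> N / 2"
    then have "b \<in> H" using b by (auto simp: H_def children_def)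
    then have "h b \<le> h a" unfolding a_max using \<open>finite H\<close> by simp
    with h_child[OF b] show False by simp
  qed
  have "2 * D * (\<Sum>x\<in>desc a. c x * d a x) = (\<Sum>b\<in>children a. 2 * D * (\<Sum>x\<in>desc b. c x * d a x))"
    unfolding sum_desc[OF aA] using d_refl[OF aA] by (simp add: sum_distrib_left)
  also have "\<dots> \<le> (\<Sum>b\<in>children a. s * ((N / 2 + D) * S b))"
  proof (rule sum_mono)
    fix b assume b: "b \<in> children a"
    have "(S b)\<^sup>2 + D * S b \<le> (N / 2 + D) * S b"
      using mult_right_mono[OF child[OF b] S0[of b]] by (simp add: power2_eq_square algebra_simps)
    then have "s * ((S b)\<^sup>2 + D * S b) \<le> s * ((N / 2 + D) * S b)"
      by (rule mult_left_mono) simp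
    then show "2 * D * (\<Sum>x\<in>desc b. c x * d a x) \<le> s * ((N / 2 + D) * S b)"
      using child_branch_bound[OF aA b] unfolding S_def by linarith
  qed
  also have "\<dots> = s * ((N / 2 + D) * (S a - c a))"
    unfolding S_def sum_desc[OF aA] by (simp add: sum_distrib_left)
  finally have down: "2 * D * (\<Sum>x\<in>desc a. c x * d a x) \<le> s * ((N / 2 + D) * (S a - c a))" .
  have "2 * D * (\<Sum>b\<in>A. c b * d a b) \<le> s * (N\<^sup>2 / 2 - (M - D)\<^sup>2 + D * N)"
  proof (cases "a = w")
    case True
    \<comment> \<open>With no upward branch, the saving comes from omitting
      \<open>c w \<ge> M\<close>. Here \<open>2 * M \<le> N\<close> enters, as
      \<open>M * M \<le> N * M / 2\<close>.\<close>
    have "(N / 2 + D) * (S a - c a) \<le> (N / 2 + D) * (N - M)"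
      using True c_root N0 D_pos by (intro mult_left_mono) (auto simp: S_def desc_root N_def)
    also have "\<dots> \<le> N\<^sup>2 / 2 - M * M + D * N - D * M"
    proof -
      have "2 * M * M \<le> N * M"
        using assms D_pos D_le_M by (intro mult_right_mono) (auto simp: N_def)
      then show ?thesis by (simp add: power2_eq_square field_simps)
    qed
    also have "\<dots> \<le> N\<^sup>2 / 2 - (M - D)\<^sup>2 + D * N"
      using mult_left_mono[of D M D] D_pos D_le_M by (simp add: power2_eq_square algebra_simps)
    finally have "s * ((N / 2 + D) * (S a - c a)) \<le> s * (N\<^sup>2 / 2 - (M - D)\<^sup>2 + D * N)"
      by (rule mult_left_mono) simp
    with down True show ?thesis by (simp add: desc_root)
  next
    case False
    define W where "W = N - S a"
    have W: "sum c (A - desc a) = W"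
      unfolding W_def N_def S_def using finite_A desc_subset by (simp add: sum_diff)
    have W0: "0 \<le> W" unfolding W[symmetric] using c0 by (intro sum_nonneg) auto
    have "W \<le> N / 2" using Sa by (simp add: W_def)
    \<comment> \<open>Since \<open>W * W \<le> (N / 2) * W\<close>, the upward branch joins the
      bound for the children, for a total weight of \<open>N - c a\<close>.\<close>
    from mult_right_mono[OF this W0]
    have "W\<^sup>2 + (N / 2 + D) * (S a - c a) + D * W \<le> (N / 2 + D) * (N - c a)"
      unfolding W_def by (simp add: power2_eq_square field_simps)
    also have "\<dots> \<le> (N / 2 + D) * N"
      using c0[OF aA] N0 D_pos by (intro mult_left_mono) auto
    finally have "W\<^sup>2 - (M - D)\<^sup>2 + D * W + (N / 2 + D) * (S a - c a) \<le> N\<^sup>2 / 2 - (M - D)\<^sup>2 + D * N"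
      by (simp add: power2_eq_square algebra_simps)
    from mult_left_mono[OF this, of "real s"]
    have "s * (W\<^sup>2 - (M - D)\<^sup>2 + D * W) + s * ((N / 2 + D) * (S a - c a))
      \<le> s * (N\<^sup>2 / 2 - (M - D)\<^sup>2 + D * N)"
      by (simp add: distrib_left)
    moreover have "(\<Sum>b\<in>A. c b * d a b) = (\<Sum>b\<in>A - desc a. c b * d a b) + (\<Sum>b\<in>desc a. c b * d a b)"
      using finite_A desc_subset by (rule sum.subset_diff[rotated])
    ultimately show ?thesis
      using down up_branch_bound[OF aA False] unfolding W by (simp add: distrib_left)
  qed
  with aA show ?thesis unfolding N_def by blast
qed

end

section \<open>Packings in finite geodesic spaces\<close>

locale finite_geodesic_space =
  fixes V :: "'a set" and d :: "'a \<Rightarrow> 'a \<Rightarrow> nat"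
  assumes finite_V: "finite V"
    and d_refl: "x \<in> V \<Longrightarrow> d x x = 0"
    and d_sym: "x \<in> V \<Longrightarrow> y \<in> V \<Longrightarrow> d x y = d y x"
    and d_triangle: "x \<in> V \<Longrightarrow> y \<in> V \<Longrightarrow> z \<in> V \<Longrightarrow> d x z \<le> d x y + d y z"
    and d_geodesic: "x \<in> V \<Longrightarrow> y \<in> V \<Longrightarrow> i \<le> d x y \<Longrightarrow> \<exists>z\<in>V. d x z = i \<and> d z y = d x y - i"
begin

text \<open>Separation 3 makes unit balls disjoint, linking steps of length at most 3 provide tree
  edges, and covering radius 2 limits the cost of moving vertices into \<open>A\<close>. Separation
  and linking are built into \<open>Q\<close>; covering follows from maximality.\<close>

lemma connected_packing_exists:
  assumes w: "w \<in> V"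
  obtains A where "A \<subseteq> V" "w \<in> A"
    "\<And>x y. x \<in> A \<Longrightarrow> y \<in> A \<Longrightarrow> x \<noteq> y \<Longrightarrow> 3 \<le> d x y"
    "\<And>u. u \<in> V \<Longrightarrow> \<exists>a\<in>A. d u a \<le> 2"
    "\<And>b. b \<in> A \<Longrightarrow> (w, b) \<in> {(x, y). x \<in> A \<and> y \<in> A \<and> d x y \<le> 3}\<^sup>*"
proof -
  define R where "R A = {(x, y). x \<in> A \<and> y \<in> A \<and> d x y \<le> 3}" for A
  define Q where "Q A \<longleftrightarrow> A \<subseteq> V \<and> w \<in> A \<and> (\<forall>x\<in>A. \<forall>y\<in>A. x \<noteq> y \<longrightarrow> 3 \<le> d x y) \<and>
    (\<forall>b\<in>A. (w, b) \<in> (R A)\<^sup>*)" for A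
  have "finite (Collect Q)"
    using finite_V by (rule finite_subset[rotated, OF iffD2[OF finite_Pow_iff]]) (auto simp: Q_def)
  moreover have "Q {w}" using w by (simp add: Q_def)
  ultimately obtain A where A: "Q A" and max: "\<And>A'. Q A' \<Longrightarrow> A \<subseteq> A' \<Longrightarrow> A = A'"
    using finite_has_maximal[of "Collect Q"] by blast
  have AV: "A \<subseteq> V" and wA: "w \<in> A" and sep: "\<And>x y. x \<in> A \<Longrightarrow> y \<in> A \<Longrightarrow> x \<noteq> y \<Longrightarrow> 3 \<le> d x y"
    and conn: "\<And>b. b \<in> A \<Longrightarrow> (w, b) \<in> (R A)\<^sup>*"
    using A by (auto simp: Q_def)
  have "\<exists>a\<in>A. d u a \<le> 2" if u: "u \<in> V" for u
  proof (rule ccontr)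
    assume "\<not> (\<exists>a\<in>A. d u a \<le> 2)"
    then have far: "3 \<le> d u a" if "a \<in> A" for a using that by force
    \<comment> \<open>The point at distance 3 from \<open>A\<close> on a geodesic from \<open>u\<close> to the nearest point of \<open>A\<close>
      could be added to \<open>A\<close>.\<close>
    obtain a where a: "a \<in> A" "\<And>b. b \<in> A \<Longrightarrow> d u a \<le> d u b"
      using ex_has_least_nat[of "\<lambda>a. a \<in> A" w "d u"] wA by blast
    obtain z where z: "z \<in> V" "d u z = d u a - 3" "d z a = 3"
      using d_geodesic[of u a "d u a - 3"] far[OF a(1)] u a(1) AV by auto
    \<comment> \<open>As \<open>a\<close> is nearest to \<open>u\<close>, every \<open>b\<close> in
      \<open>A\<close> satisfies \<open>d u b \<ge> d u a = d u z + 3\<close>.\<close>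
    have zfar: "3 \<le> d z b" "3 \<le> d b z" if "b \<in> A" for b
    proof -
      have "d u b \<le> d u z + d z b" using u z that AV by (intro d_triangle) auto
      then show "3 \<le> d z b" using a(2)[OF that] z far[OF a(1)] by linarith
      then show "3 \<le> d b z" using d_sym[of z b] z that AV by auto
    qed
    have "z \<notin> A" using zfar[of z] z d_refl[of z] by auto
    have mono: "(R A)\<^sup>* \<subseteq> (R (insert z A))\<^sup>*" by (intro rtrancl_mono) (auto simp: R_def)
    moreover have "(a, z) \<in> R (insert z A)"
      using a z d_sym[of a z] AV by (auto simp: R_def)
    ultimately have "(w, z) \<in> (R (insert z A))\<^sup>*"
      using conn[OF a(1)] by (meson rtrancl_into_rtrancl subsetD)
    then have "Q (insert z A)"
      using AV wA sep zfar z conn mono by (auto simp: Q_def)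
    with max[of "insert z A"] \<open>z \<notin> A\<close> show False by auto
  qed
  then show thesis using that AV wA sep conn unfolding R_def by blast
qed

text \<open>Every vertex \<open>u\<close> moves to some \<open>g u\<close> in \<open>A\<close>, and
  \<open>c\<close> counts the fibres of \<open>g\<close>. Moving by at most 2 costs at most
  \<open>2 * card V\<close> in a distance sum; the factor \<open>2 * D\<close> matches the branch
  bounds.\<close>

lemma weighted_tree_exists:
  fixes D M :: nat
  assumes w: "w \<in> V" and D: "0 < D" "D \<le> M"
    and ball: "\<And>v. v \<in> V \<Longrightarrow> D \<le> card {u \<in> V. d v u \<le> 1}"
    and ball_w: "M \<le> card {u \<in> V. d w u \<le> 1}"
  shows "\<exists>A p h. \<exists>c :: 'a \<Rightarrow> real. weighted_tree A w p h c (real D) (real M) d 3 \<and>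
    A \<subseteq> V \<and> sum c A = card V \<and>
    (\<forall>a\<in>V. 2 * D * (\<Sum>u\<in>V. real (d a u)) \<le> 4 * D * real (card V) + 2 * D * (\<Sum>b\<in>A. c b * d a b))"
proof -
  obtain A where A: "A \<subseteq> V" "w \<in> A"
    and sep: "\<And>x y. x \<in> A \<Longrightarrow> y \<in> A \<Longrightarrow> x \<noteq> y \<Longrightarrow> 3 \<le> d x y"
    and cover: "\<And>u. u \<in> V \<Longrightarrow> \<exists>a\<in>A. d u a \<le> 2"
    and conn: "\<And>b. b \<in> A \<Longrightarrow> (w, b) \<in> {(x, y). x \<in> A \<and> y \<in> A \<and> d x y \<le> 3}\<^sup>*"
    using connected_packing_exists[OF w] by blast
  have finA: "finite A" using A finite_V finite_subset by blast
  obtain h :: "'a \<Rightarrow> nat" where hw: "h w = 0"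
    and h: "\<And>b. b \<in> A \<Longrightarrow> b \<noteq> w \<Longrightarrow>
      \<exists>b'\<in>A. (b', b) \<in> {(x, y). x \<in> A \<and> y \<in> A \<and> d x y \<le> 3} \<and> h b = Suc (h b')"
  proof (rule connected_depth_exists[OF _ A(2) conn])
    show "{(x, y). x \<in> A \<and> y \<in> A \<and> d x y \<le> 3} \<subseteq> A \<times> A" by auto
  qed auto
  have "\<forall>b\<in>A - {w}. \<exists>b'. b' \<in> A \<and> d b' b \<le> 3 \<and> h b = Suc (h b')"
    using h by blast
  from bchoice[OF this] obtain p
    where p: "\<And>b. b \<in> A \<Longrightarrow> b \<noteq> w \<Longrightarrow> p b \<in> A \<and> d (p b) b \<le> 3 \<and> h b = Suc (h (p b))"
    by blast
  \<comment> \<open>A vertex within distance 1 of \<open>A\<close> must go to that element, so that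
    fibres contain whole unit balls. The element is unique, since two would be at distance at most
    2.\<close>
  have "\<exists>a. a \<in> A \<and> d u a \<le> 2 \<and> (\<forall>b\<in>A. d u b \<le> 1 \<longrightarrow> a = b)" if u: "u \<in> V" for u
  proof (cases "\<exists>a\<in>A. d u a \<le> 1")
    case True
    then obtain a where a: "a \<in> A" "d u a \<le> 1" by auto
    have "a = b" if b: "b \<in> A" "d u b \<le> 1" for b
    proof (rule ccontr)
      assume "a \<noteq> b"
      have "d a b \<le> d a u + d u b" using a b u A by (intro d_triangle) auto
      then show False using sep[OF a(1) b(1) \<open>a \<noteq> b\<close>] d_sym[of a u] a b u A by auto
    qed
    moreover have "d u a \<le> 2" using a by simp
    ultimately show ?thesis using a(1) by blast
  next
    case False
    then show ?thesis using cover[OF u] by blast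
  qed
  then have "\<forall>u\<in>V. \<exists>a. a \<in> A \<and> d u a \<le> 2 \<and> (\<forall>b\<in>A. d u b \<le> 1 \<longrightarrow> a = b)"
    by blast
  from bchoice[OF this] obtain g
    where g: "\<And>u. u \<in> V \<Longrightarrow> g u \<in> A \<and> d u (g u) \<le> 2 \<and> (\<forall>b\<in>A. d u b \<le> 1 \<longrightarrow> g u = b)"
    by blast
  define c where "c a = real (card {u \<in> V. g u = a})" for a
  have c_ball: "card {u \<in> V. d a u \<le> 1} \<le> c a" if "a \<in> A" for a
    unfolding c_def of_nat_le_iff
  proof (rule card_mono)
    show "finite {u \<in> V. g u = a}" using finite_V by simp
    show "{u \<in> V. d a u \<le> 1} \<subseteq> {u \<in> V. g u = a}"
    proof safe
      fix u assume "u \<in> V" "d a u \<le> 1"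
      then show "g u = a" using g[of u] d_sym[of a u] that A by auto
    qed
  qed
  have group: "(\<Sum>b\<in>A. c b * f b) = (\<Sum>u\<in>V. f (g u))" for f :: "'a \<Rightarrow> real"
  proof -
    have "(\<Sum>u\<in>V. f (g u)) = (\<Sum>b\<in>A. \<Sum>u\<in>{u \<in> V. g u = b}. f (g u))"
      using finite_V finA g by (intro sum.group[symmetric]) auto
    also have "\<dots> = (\<Sum>b\<in>A. c b * f b)"
      unfolding c_def by (intro sum.cong refl) simp
    finally show ?thesis by simp
  qed
  show ?thesis
  proof (intro exI conjI ballI)
    show "weighted_tree A w p h c (real D) (real M) d 3"
    proof
      fix b assume b: "b \<in> A"
      then have "D \<le> card {u \<in> V. d b u \<le> 1}" using ball A by auto
      then show "real D \<le> c b" using c_ball[OF b] by linarith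
      show "d b (p b) \<le> 3" if "b \<noteq> w"
        using p[OF b that] d_sym[of b "p b"] b A(1) by (simp add: subset_iff)
    next
      show "real M \<le> c w" using c_ball[OF A(2)] ball_w by linarith
    qed (use finA A(2) hw p D d_refl d_sym d_triangle subsetD[OF A(1)] in simp_all)
    show "A \<subseteq> V" by fact
    show "sum c A = card V" using group[of "\<lambda>_. 1"] by simp
    fix a assume a: "a \<in> V"
    have "(\<Sum>u\<in>V. real (d a u)) \<le> (\<Sum>u\<in>V. 2 + real (d a (g u)))"
    proof (rule sum_mono)
      fix u assume u: "u \<in> V"
      then have gu: "g u \<in> V" "d u (g u) \<le> 2" using g A by auto
      have "d a u \<le> d a (g u) + d (g u) u" using a u gu by (intro d_triangle) auto
      then show "real (d a u) \<le> 2 + real (d a (g u))"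
        using gu d_sym[OF u gu(1)] by linarith
    qed
    then have "(\<Sum>u\<in>V. real (d a u)) \<le> 2 * real (card V) + (\<Sum>b\<in>A. c b * d a b)"
      unfolding group[of "\<lambda>b. real (d a b)"] by (simp add: sum.distrib)
    from mult_left_mono[OF this, of "2 * D"]
    show "2 * D * (\<Sum>u\<in>V. real (d a u)) \<le> 4 * D * real (card V) + 2 * D * (\<Sum>b\<in>A. c b * d a b)"
      by (simp add: algebra_simps)
  qed
qed

lemma distance_sum_root:
  fixes D M :: nat and n :: real
  assumes w: "w \<in> V" and D: "0 < D" "D \<le> M"
    and ball: "\<And>v. v \<in> V \<Longrightarrow> D \<le> card {u \<in> V. d v u \<le> 1}"
    and ball_w: "M \<le> card {u \<in> V. d w u \<le> 1}"
    and n: "n = card V"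
  shows "2 * D * (\<Sum>u\<in>V. real (d w u)) \<le> 4 * D * n + 3 * ((n - M)\<^sup>2 + D * (n - M))"
proof -
  obtain A p h and c :: "'a \<Rightarrow> real" where tree: "weighted_tree A w p h c (real D) (real M) d 3"
    and A: "A \<subseteq> V" and N: "sum c A = n"
    and le: "\<And>a. a \<in> V \<Longrightarrow> 2 * D * (\<Sum>u\<in>V. real (d a u)) \<le> 4 * D * n + 2 * D * (\<Sum>b\<in>A. c b * d a b)"
    using weighted_tree_exists[OF w D ball ball_w, folded n] by blast
  interpret weighted_tree A w p h c "real D" "real M" d 3 by (fact tree)
  \<comment> \<open>Keeps \<open>n - c w\<close> nonnegative, so that its square is monotone when
    \<open>c w\<close> is lowered to \<open>M\<close>.\<close>
  have "c w \<le> n"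
    unfolding N[symmetric] using finite_A root_in c_ge D_pos by (intro member_le_sum) force+
  then have "(n - c w)\<^sup>2 + D * (n - c w) \<le> (n - M)\<^sup>2 + D * (n - M)"
    using c_root by (intro add_mono power_mono mult_left_mono) auto
  then show ?thesis
    using le[OF w] root_bound unfolding N by simp
qed

lemma distance_sum_median:
  fixes D M :: nat and n :: real
  assumes w: "w \<in> V" and D: "0 < D" "D \<le> M"
    and ball: "\<And>v. v \<in> V \<Longrightarrow> D \<le> card {u \<in> V. d v u \<le> 1}"
    and ball_w: "M \<le> card {u \<in> V. d w u \<le> 1}"
    and n: "n = card V"
    and half: "2 * M \<le> n"
  shows "\<exists>a\<in>V. 2 * D * (\<Sum>u\<in>V. real (d a u)) \<le>
    4 * D * n + 3 * (n\<^sup>2 / 2 - (real M - real D)\<^sup>2 + D * n)"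
proof -
  obtain A p h and c :: "'a \<Rightarrow> real" where tree: "weighted_tree A w p h c (real D) (real M) d 3"
    and A: "A \<subseteq> V" and N: "sum c A = n"
    and le: "\<And>a. a \<in> V \<Longrightarrow> 2 * D * (\<Sum>u\<in>V. real (d a u)) \<le> 4 * D * n + 2 * D * (\<Sum>b\<in>A. c b * d a b)"
    using weighted_tree_exists[OF w D ball ball_w, folded n] by blast
  interpret weighted_tree A w p h c "real D" "real M" d 3 by (fact tree)
  obtain a where a: "a \<in> A" and "2 * D * (\<Sum>b\<in>A. c b * d a b) \<le>
      3 * (n\<^sup>2 / 2 - (real M - real D)\<^sup>2 + D * n)"
    using median_bound half unfolding N by auto
  moreover have "a \<in> V" using a A by blast
  ultimately show ?thesis
    using le[of a] by (intro bexI[of _ a]) linarith+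
qed

end

section \<open>Shortest walks: graphs as geodesic spaces\<close>

text \<open>A natural-number version of \<open>distance\<close>, agreeing with it whenever a walk
  exists.\<close>

definition hops :: "('a, 'b) pre_digraph \<Rightarrow> 'a \<Rightarrow> 'a \<Rightarrow> nat" where
  "hops G u v = (LEAST k. \<exists>p. pre_digraph.awalk G u p v \<and> length p = k)"

lemma (in wf_digraph) hops_le: "awalk u p v \<Longrightarrow> hops G u v \<le> length p"
  unfolding hops_def by (auto intro: Least_le)

lemma (in wf_digraph) hops_awalk:
  assumes "u \<rightarrow>\<^sup>* v"
  obtains p where "awalk u p v" "length p = hops G u v"
proof -
  obtain q where "awalk u q v" using assms by (auto simp: reachable_awalk)
  then have "\<exists>k p. awalk u p v \<and> length p = k" by blast
  from LeastI_ex[OF this] show thesis using that unfolding hops_def by blast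
qed

lemma (in wf_digraph) distance_eq_hops:
  assumes "u \<rightarrow>\<^sup>* v"
  shows "distance G u v = hops G u v"
proof -
  have cost: "awalk_cost (\<lambda>_. 1) p = length p" for p
    by (induction p) auto
  obtain p where p: "awalk u p v" "length p = hops G u v" using hops_awalk[OF assms] .
  have "\<mu> (\<lambda>_. 1) u v = ereal (hops G u v)"
    unfolding \<mu>_def
  proof (rule antisym)
    show "(INF p\<in>{p. awalk u p v}. ereal (awalk_cost (\<lambda>_. 1) p)) \<le> ereal (hops G u v)"
      using p by (intro INF_lower2[of p]) (auto simp: cost)
    show "ereal (hops G u v) \<le> (INF p\<in>{p. awalk u p v}. ereal (awalk_cost (\<lambda>_. 1) p))"
      using hops_le by (intro INF_greatest) (auto simp: cost)
  qed
  then show ?thesis by (simp add: distance_def)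
qed

text \<open>Each arc is replaced by an opposite arc, which symmetry provides.\<close>

lemma (in sym_digraph) awalk_reverse:
  "awalk u p v \<Longrightarrow> \<exists>q. awalk v q u \<and> length q = length p"
proof (induction p arbitrary: u)
  case (Cons e p)
  then have e: "e \<in> arcs G" "tail G e = u" and p: "awalk (head G e) p v"
    by (auto simp: awalk_Cons_iff)
  then obtain q where q: "awalk v q (head G e)" "length q = length p" using Cons.IH by blast
  have "(head G e, u) \<in> arcs_ends G"
    using e sym_arcs unfolding symmetric_def by (auto simp: arcs_ends_def arc_to_ends_def dest: symD)
  then obtain e' where "e' \<in> arcs G" "tail G e' = head G e" "head G e' = u"
    by (auto simp: arcs_ends_def arc_to_ends_def)
  then have "awalk (head G e) [e'] u" by (auto simp: awalk_simps)
  with q show ?case by (intro exI[of _ "q @ [e']"]) (auto intro: awalk_appendI)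
qed (auto simp: awalk_simps)

lemma (in graph) finite_geodesic_space_hops:
  assumes "strongly_connected G"
  shows "finite_geodesic_space (verts G) (hops G)"
proof
  have reach: "u \<rightarrow>\<^sup>* v" if "u \<in> verts G" "v \<in> verts G" for u v
    using assms that by auto
  show "hops G x x = 0" if "x \<in> verts G" for x
    using hops_le[of x "[]" x] that by (simp add: awalk_simps)
  have sym_le: "hops G x y \<le> hops G y x" if xy: "x \<in> verts G" "y \<in> verts G" for x y
  proof -
    obtain p where p: "awalk y p x" "length p = hops G y x" using hops_awalk[OF reach] xy by metis
    with awalk_reverse[OF p(1)] hops_le show ?thesis by metis
  qed
  then show "hops G x y = hops G y x" if "x \<in> verts G" "y \<in> verts G" for x y
    using that by (simp add: antisym)
  show tri: "hops G x z \<le> hops G x y + hops G y z"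
    if xyz: "x \<in> verts G" "y \<in> verts G" "z \<in> verts G" for x y z
  proof -
    obtain p q where p: "awalk x p y" "length p = hops G x y" and q: "awalk y q z" "length q = hops G y z"
      using hops_awalk[OF reach] xyz by metis
    with hops_le[OF awalk_appendI[OF p(1) q(1)]] show ?thesis by simp
  qed
  fix x y i assume xy: "x \<in> verts G" "y \<in> verts G" and i: "i \<le> hops G x y"
  obtain p where p: "awalk x p y" "length p = hops G x y" using hops_awalk[OF reach] xy by metis
  have "awalk x (take i p @ drop i p) y" using p by simp
  then obtain z where z: "awalk x (take i p) z" "awalk z (drop i p) y"
    unfolding awalk_append_iff by blast
  then have zV: "z \<in> verts G" by auto
  \<comment> \<open>Cutting a shortest walk after \<open>i\<close> arcs gives only upper bounds; the
    triangle inequality turns both into equalities.\<close>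
  have "hops G x z \<le> i" "hops G z y \<le> hops G x y - i"
    using hops_le[OF z(1)] hops_le[OF z(2)] p i by auto
  with tri[OF xy(1) zV xy(2)] i zV
  show "\<exists>z\<in>verts G. hops G x z = i \<and> hops G z y = hops G x y - i"
    by (intro bexI[of _ z]) auto
qed simp

text \<open>Without parallel arcs the heads of the arcs leaving \<open>v\<close> are distinct, and
  without loops \<open>v\<close> itself adds one more vertex.\<close>

lemma (in graph) out_degree_le_hops_ball:
  assumes v: "v \<in> verts G"
  shows "out_degree G v + 1 \<le> card {u \<in> verts G. hops G v u \<le> 1}"
proof -
  have inj: "inj_on (head G) (out_arcs G v)"
    using no_multi_arcs by (auto simp: inj_on_def arc_to_ends_def)
  have "v \<notin> head G ` out_arcs G v" using no_loops by force
  then have "out_degree G v + 1 = card (insert v (head G ` out_arcs G v))"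
    using card_image[OF inj] by (simp add: out_degree_def finite_out_arcs)
  also have "\<dots> \<le> card {u \<in> verts G. hops G v u \<le> 1}"
  proof (rule card_mono)
    have "hops G v v \<le> 1" using hops_le[of v "[]" v] v by (simp add: awalk_simps)
    moreover have "hops G v (head G e) \<le> 1" if "e \<in> out_arcs G v" for e
      using hops_le[of v "[e]" "head G e"] that by (auto simp: awalk_simps)
    ultimately show "insert v (head G ` out_arcs G v) \<subseteq> {u \<in> verts G. hops G v u \<le> 1}"
      using v by auto
  qed simp
  finally show ?thesis .
qed

section \<open>Degrees and the two proximity bounds\<close>

context graph
begin

lemma min_degree_le_hops_ball:
  assumes "v \<in> verts G"
  shows "min_degree G + 1 \<le> card {u \<in> verts G. hops G v u \<le> 1}"
proof -
  have "min_degree G \<le> out_degree G v"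
    unfolding min_degree_def using assms by simp
  then show ?thesis using out_degree_le_hops_ball[OF assms] by linarith
qed

lemma max_degree_vertex:
  assumes "verts G \<noteq> {}"
  obtains w where "w \<in> verts G" "min_degree G \<le> max_degree G"
    "max_degree G + 1 \<le> card {u \<in> verts G. hops G w u \<le> 1}"
proof -
  have "max_degree G \<in> out_degree G ` verts G"
    unfolding max_degree_def using assms by (intro Max_in) auto
  then obtain w where w: "w \<in> verts G" "out_degree G w = max_degree G" by auto
  moreover have "min_degree G \<le> out_degree G w"
    unfolding min_degree_def using w(1) by simp
  ultimately show thesis using that out_degree_le_hops_ball[OF w(1)] by simp
qed

text \<open>One vertex with a small distance sum suffices. The factor \<open>2 * E\<close>, with
  \<open>E\<close> equal to \<delta> + 1 later, matches the form of the distance sum bounds.\<close>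

lemma proximity_le_hops_sum:
  assumes "strongly_connected G" "a \<in> verts G" "2 \<le> card (verts G)" "0 < E"
    and le: "2 * E * (\<Sum>u\<in>verts G. real (hops G a u)) \<le> 2 * E * (real (card (verts G)) - 1) * X"
  shows "proximity G \<le> X"
proof -
  have "2 * E * (\<Sum>u\<in>verts G. real (hops G a u)) \<le> 2 * E * ((real (card (verts G)) - 1) * X)"
    using le by (simp add: mult.assoc)
  then have sum_le: "(\<Sum>u\<in>verts G. real (hops G a u)) \<le> (real (card (verts G)) - 1) * X"
    using \<open>0 < E\<close> by (subst (asm) mult_le_cancel_left_pos) auto
  have "(\<Sum>u\<in>verts G. distance G a u) = (\<Sum>u\<in>verts G. real (hops G a u))"
    using assms(1,2) by (intro sum.cong refl distance_eq_hops) auto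
  then have avg: "average_distance G a = (\<Sum>u\<in>verts G. real (hops G a u)) / (real (card (verts G)) - 1)"
    by (simp add: average_distance_def)
  have "proximity G \<le> average_distance G a"
    unfolding proximity_def using assms(2) by (intro Min_le) auto
  also have "\<dots> \<le> X"
    using sum_le assms(3) unfolding avg by (simp add: pos_divide_le_eq mult.commute)
  finally show ?thesis .
qed

lemma proximity_le_of_large_max_degree:
  defines "N \<equiv> real (card (verts G))" and "E \<equiv> real (min_degree G) + 1"
  assumes sc: "strongly_connected G" and n: "2 \<le> card (verts G)"
    and large: "real (max_degree G) > N / 2 - 1"
  shows "proximity G \<le> 3 * (N - real (max_degree G))\<^sup>2 / (2 * (N - 1) * E) + 13 / 2"
proof -
  define K where "K = real (max_degree G) + 1"
  have ne: "verts G \<noteq> {}" using sc by (simp add: strongly_connected_def)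
  obtain w where w: "w \<in> verts G" and D: "min_degree G \<le> max_degree G"
    and ball_w: "max_degree G + 1 \<le> card {u \<in> verts G. hops G w u \<le> 1}"
    by (rule max_degree_vertex[OF ne])
  have "card {u \<in> verts G. hops G w u \<le> 1} \<le> card (verts G)" by (intro card_mono) auto
  with ball_w have K: "K \<le> N" by (simp add: K_def N_def)
  have E: "0 < E" and N: "2 \<le> N" and half: "N < 2 * K"
    using n large by (auto simp: E_def N_def K_def)
  have "2 * E * (\<Sum>u\<in>verts G. real (hops G w u)) \<le> 4 * E * N + 3 * ((N - K)\<^sup>2 + E * (N - K))"
    using finite_geodesic_space.distance_sum_root[OF finite_geodesic_space_hops[OF sc] w _ _
        min_degree_le_hops_ball ball_w refl] D
    by (simp add: E_def N_def K_def add.commute)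
  \<comment> \<open>Source of 13/2: \<open>N < 2 * K\<close> gives
    \<open>4 * N + 3 * (N - K) \<le> 11 * N / 2\<close>, which is at most
    \<open>13 * (N - 1)\<close> for \<open>N \<ge> 2\<close>. The shift \<open>N - K + 1\<close> is
    \<open>N\<close> minus the maximum degree.\<close>
  also have "\<dots> \<le> 3 * (N - K + 1)\<^sup>2 + 13 * E * (N - 1)"
  proof -
    have "(N - K)\<^sup>2 \<le> (N - K + 1)\<^sup>2" using K by (intro power_mono) auto
    moreover have "E * (4 * N + 3 * (N - K)) \<le> E * (13 * (N - 1))"
      using E N half by (intro mult_left_mono) auto
    ultimately show ?thesis by (simp add: algebra_simps)
  qed
  also have "\<dots> = 2 * E * (N - 1) * (3 * (N - real (max_degree G))\<^sup>2 / (2 * (N - 1) * E) + 13 / 2)"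
    using E N by (simp add: K_def field_simps)
  finally show ?thesis
    unfolding N_def by (rule proximity_le_hops_sum[OF sc w n E])
qed

lemma proximity_le_of_small_max_degree:
  defines "N \<equiv> real (card (verts G))" and "E \<equiv> real (min_degree G) + 1"
  assumes sc: "strongly_connected G" and n: "2 \<le> card (verts G)"
    and small: "real (max_degree G) \<le> N / 2 - 1"
  shows "proximity G \<le> 3 * (N\<^sup>2 - 2 * (real (max_degree G))\<^sup>2) / (4 * (N - 1) * E) + 35 / 4"
proof -
  define K where "K = real (max_degree G) + 1"
  have ne: "verts G \<noteq> {}" using sc by (simp add: strongly_connected_def)
  obtain w where w: "w \<in> verts G" and D: "min_degree G \<le> max_degree G"
    and ball_w: "max_degree G + 1 \<le> card {u \<in> verts G. hops G w u \<le> 1}"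
    by (rule max_degree_vertex[OF ne])
  have E: "1 \<le> E" "E \<le> K" and N: "2 \<le> N" and half: "2 * K \<le> N"
    using n small D by (auto simp: E_def N_def K_def)
  have "2 * real (max_degree G + 1) \<le> N" using half by (simp add: K_def)
  then obtain a where a: "a \<in> verts G"
    and le: "2 * E * (\<Sum>u\<in>verts G. real (hops G a u)) \<le> 4 * E * N + 3 * (N\<^sup>2 / 2 - (K - E)\<^sup>2 + E * N)"
    using finite_geodesic_space.distance_sum_median[OF finite_geodesic_space_hops[OF sc] w _ _
        min_degree_le_hops_ball ball_w N_def[THEN meta_eq_to_obj_eq]] D
    by (auto simp: E_def K_def add.commute)
  note le
  also have "4 * E * N + 3 * (N\<^sup>2 / 2 - (K - E)\<^sup>2 + E * N)
    \<le> 3 * (N\<^sup>2 - 2 * (K - 1)\<^sup>2) / 2 + 35 / 2 * E * (N - 1)"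
  \<comment> \<open>The general estimate requires \<open>N \<ge> 7 / 3\<close>. Order 2 forces
    \<open>K = E = 1\<close> and is checked numerically.\<close>
  proof (cases "card (verts G) = 2")
    case True
    then have "N = 2" "K = 1" "E = 1"
      using half E by (auto simp: N_def)
    then show ?thesis by simp
  next
    case False
    then have N3: "3 \<le> N" using n by (simp add: N_def)
    \<comment> \<open>Source of 35/4: expanding the square moves \<open>6 * E * K\<close> into the
      error, and \<open>2 * K \<le> N\<close> gives
      \<open>7 * N + 6 * K \<le> 10 * N \<le> 35 / 2 * (N - 1)\<close> for
      \<open>N \<ge> 3\<close>.\<close>
    have "(K - 1)\<^sup>2 \<le> K\<^sup>2" using E by (intro power_mono) auto
    moreover have "K\<^sup>2 - 2 * E * K \<le> (K - E)\<^sup>2" by (simp add: power2_eq_square algebra_simps)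
    moreover have "E * (7 * N + 6 * K) \<le> E * (35 / 2 * (N - 1))"
      using E N3 half by (intro mult_left_mono) auto
    ultimately show ?thesis by (simp add: field_simps)
  qed
  also have "\<dots> = 2 * E * (N - 1) * (3 * (N\<^sup>2 - 2 * (real (max_degree G))\<^sup>2) / (4 * (N - 1) * E) + 35 / 4)"
    using E N by (simp add: K_def field_simps)
  finally show ?thesis
    unfolding N_def using E by (intro proximity_le_hops_sum[OF sc a n, of E]) auto
qed

end

theorem theorem3p1:
  fixes G :: "('a, 'b) pre_digraph" and n \<delta> \<Delta> :: nat
  assumes "graph G" and "Digraph_Component.connected G"
    and "n = card (verts G)" and "n \<ge> 2"
    and "\<delta> = min_degree G" and "\<Delta> = max_degree G"
  shows "(real \<Delta> > real n / 2 - 1 \<longrightarrow>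
            proximity G \<le> 3 * (real n - real \<Delta>)^2 / (2 * (real n - 1) * (real \<delta> + 1)) + 13 / 2) \<and>
         (real \<Delta> \<le> real n / 2 - 1 \<longrightarrow>
            proximity G \<le> 3 * ((real n)^2 - 2 * (real \<Delta>)^2) / (4 * (real n - 1) * (real \<delta> + 1)) + 35 / 4)"
proof -
  have wf: "wf_digraph G" and sym: "symmetric G"
    using assms(1) by (auto simp: graph_def pseudo_graph_def sym_digraph_def sym_digraph_axioms_def)
  \<comment> \<open>\<open>connected\<close> concerns the underlying undirected graph; symmetry of
    the arcs makes it strong connectivity.\<close>
  have "strongly_connected G"
    using wf_digraph.symmetric_connected_imp_strongly_connected[OF wf sym assms(2)] .
  then show ?thesis
    using graph.proximity_le_of_large_max_degree[OF assms(1)]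
      graph.proximity_le_of_small_max_degree[OF assms(1)] assms(3-6)
    by blast
qed

end
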